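(* Let $A,H,K$ be logically independent events, let $x,y\in[0,1]$, and consider the conjunction $(A|H)\wedge(A|K)$ with $P(A|H)=x$, $P(A|K)=y$. Given any $\lambda\in[0,1]$, let $T_\lambda$ be the Frank t-norm with parameter $\lambda$. Then the assessment $z=T_\lambda(x,y)$ on $(A|H)\wedge(A|K)$ is a coherent extension of the assessment $(x,y)$ on $\{A|H,A|K\}$ (that is, $(x,y,z)$ is a coherent assessment on $\{A|H,\,A|K,\,(A|H)\wedge(A|K)\}$); moreover, with this $z$, $(A|H)\wedge(A|K)=T_\lambda(A|H,A|K)$ as random quantities. Conversely, given any coherent extension $z=\mathbb{P}[(A|H)\wedge(A|K)]$ of $(x,y)$, there exists $\lambda\in[0,1]$ such that $z=T_\lambda(x,y)$.
   Context: **Events.** Events are subsets of a set $\Omega$ of elementary outcomes; $\overline{E}$ is the complement of $E$, juxtaposition $EF$ denotes intersection, $\vee$ denotes union, and an event is true at an outcome belonging to it. Events $E_1,\dots,E_n$ are logically independent if all $2^n$ intersections $E_1^*\cdots E_n^*$, with $E_i^*\in\{E_i,\overline{E}_i\}$, are nonempty. **Conditional events.** For $H\neq\emptyset$ and an assessed probability $P(A|H)=x$, the conditional event $A|H$ is identified with the random quantity equal to $1$ on $AH$, $0$ on $\overline{A}H$, and $x$ on $\overline{H}$. It is a conditional random quantity with conditioning event $H$ and prevision $x$. **Conjunction.** Given $P(A|H)=x$, $P(A|K)=y$, the conjunction $(A|H)\wedge(A|K)$, with prevision $z=\mathbb{P}[(A|H)\wedge(A|K)]$, is the random quantity equal to: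 $1$ on $AHK$; $0$ on $\overline{A}H\vee\overline{A}K$; $x$ on $\overline{H}AK$; $y$ on $AH\overline{K}$; $z$ on $\overline{H}\,\overline{K}$. It is a conditional random quantity with conditioning event $H\vee K$ and prevision $z$. **Coherence.** Let $\mathcal F=\{X_1|H_1,\dots,X_n|H_n\}$ be a finite family of conditional random quantities, where $X_i$ takes finitely many real values when the conditioning event $H_i\ne\emptyset$ is true, and let $\mathcal M=(\mu_1,\dots,\mu_n)\in\mathbb R^n$ be a (prevision) assessment, $\mu_i=\mathbb P(X_i|H_i)$. Let $C_1,\dots,C_m$ be the constituents contained in $H_1\vee\cdots\vee H_n$, i.e. the nonempty atoms of the finite partition generated by the events $H_i$ and the events $(X_i=\text{value})\cap H_i$. To $C_h$ associate $Q_h=(q_{h1},\dots,q_{hn})$, where $q_{hi}$ is the value of $X_i$ on $C_h$ if $C_h\subseteq H_i$, and $q_{hi}=\mu_i$ if $C_h\subseteq\overline{H}_i$. Let $S$ be the set of vectors $(\lambda_1,\dots,\lambda_m)$ with $\lambda_h\ge 0$, $\sum_h\lambda_h=1$, $\sum_h\lambda_hQ_h=\mathcal M$, and, when $S\neq\emptyset$, let $I_0=\{i:\max_{\Lambda\in S}\sum_{h:C_h\subseteq H_i}\lambda_h=0\}$. Then $\mathcal M$ is coherent on $\mathcal F$ if and only if (i) $S\neq\emptyset$, and (ii) if $I_0\ne\emptyset$, then the sub-assessment $(\mu_i,\ i\in I_0)$ on $\{X_i|H_i,\ i\in I_0\}$ is coherent (the recursion terminates because $I_0$ is a proper subset of $\{1,\dots,n\}$).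 **Frank t-norms.** For $\lambda\in[0,+\infty]$, $T_\lambda:[0,1]^2\to[0,1]$ is defined by $T_0(u,v)=\min\{u,v\}$, $T_1(u,v)=uv$, $T_{+\infty}(u,v)=\max\{u+v-1,0\}$, and $T_\lambda(u,v)=\log_\lambda\!\left(1+\frac{(\lambda^u-1)(\lambda^v-1)}{\lambda-1}\right)$ otherwise. *)

theory Defs
  imports "HOL-Analysis.Analysis"
begin

text \<open>The set of elementary outcomes is the universe of the type \<open>'w\<close>; events are of type \<open>'w set\<close>.\<close>

definition logically_independent :: "'w set list \<Rightarrow> bool" where
  "logically_independent Es \<longleftrightarrow>
     (\<forall>Fs. list_all2 (\<lambda>F E. F \<in> {E, - E}) Fs Es \<longrightarrow> \<Inter> (set Fs) \<noteq> {})"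


subsection \<open>Conditional random quantities\<close>

text \<open>A conditional random quantity \<open>X|H\<close> consists of a function \<open>X\<close> on the outcomes and the
  conditioning event \<open>H\<close>. Coherence depends only on the values of \<open>X\<close> on \<open>H\<close>; in the two instances
  below, the value off \<open>H\<close> is the assessed prevision, so that \<open>rq\<close> is the random quantity with
  which the conditional object is identified.\<close>

datatype 'w crq = CRQ (rq: "'w \<Rightarrow> real") (cond: "'w set")

definition cond_event :: "'w set \<Rightarrow> 'w set \<Rightarrow> real \<Rightarrow> 'w crq" where
  "cond_event A H x =
     CRQ (\<lambda>w. if w \<in> A \<inter> H then 1 else if w \<in> - A \<inter> H then 0 else x) H"

text \<open>The conjunction of \<open>A|H\<close> and \<open>A|K\<close>, assessed at \<open>x\<close> and \<open>y\<close>, with prevision \<open>z\<close>. The last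
  case is \<open>- H \<inter> - K\<close>.\<close>

definition conjunction :: "'w set \<Rightarrow> 'w set \<Rightarrow> 'w set \<Rightarrow> real \<Rightarrow> real \<Rightarrow> real \<Rightarrow> 'w crq" where
  "conjunction A H K x y z =
     CRQ (\<lambda>w. if w \<in> A \<inter> H \<inter> K then 1
              else if w \<in> (- A \<inter> H) \<union> (- A \<inter> K) then 0
              else if w \<in> - H \<inter> A \<inter> K then x
              else if w \<in> A \<inter> H \<inter> - K then y
              else z) (H \<union> K)"


subsection \<open>Coherence\<close>

definition atoms :: "'w set set \<Rightarrow> 'w set set" where
  "atoms G = range (\<lambda>w. {w'. \<forall>E\<in>G. w' \<in> E \<longleftrightarrow> w \<in> E})"

definition generating_events :: "('i \<Rightarrow> 'w crq) \<Rightarrow> 'i set \<Rightarrow> 'w set set" where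
  "generating_events F I =
     {cond (F i) |i. i \<in> I} \<union> {{w. rq (F i) w = v} \<inter> cond (F i) |i v. i \<in> I}"

definition constituents :: "('i \<Rightarrow> 'w crq) \<Rightarrow> 'i set \<Rightarrow> 'w set set" where
  "constituents F I = {C \<in> atoms (generating_events F I). C \<subseteq> (\<Union>i\<in>I. cond (F i))}"

text \<open>A constituent \<open>C\<close> lies either inside \<open>cond (F i)\<close>, where \<open>rq (F i)\<close> is constant on \<open>C\<close>, or
  inside its complement.\<close>

definition point :: "('i \<Rightarrow> 'w crq) \<Rightarrow> ('i \<Rightarrow> real) \<Rightarrow> 'w set \<Rightarrow> 'i \<Rightarrow> real" where
  "point F \<mu> C i = (if C \<subseteq> cond (F i) then the_elem (rq (F i) ` C) else \<mu> i)"

text \<open>Weight vectors are functions on constituents; their values elsewhere are irrelevant.\<close>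

definition solutions :: "('i \<Rightarrow> 'w crq) \<Rightarrow> ('i \<Rightarrow> real) \<Rightarrow> 'i set \<Rightarrow> ('w set \<Rightarrow> real) set" where
  "solutions F \<mu> I =
     {L. (\<forall>C\<in>constituents F I. 0 \<le> L C) \<and>
         (\<Sum>C\<in>constituents F I. L C) = 1 \<and>
         (\<forall>i\<in>I. (\<Sum>C\<in>constituents F I. L C * point F \<mu> C i) = \<mu> i)}"

definition cond_mass :: "('i \<Rightarrow> 'w crq) \<Rightarrow> 'i set \<Rightarrow> 'i \<Rightarrow> ('w set \<Rightarrow> real) \<Rightarrow> real" where
  "cond_mass F I i L = (\<Sum>C | C \<in> constituents F I \<and> C \<subseteq> cond (F i). L C)"

text \<open>The set \<open>I\<^sub>0\<close>. Where the set of solutions is nonempty, the supremum is a maximum, since up to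
  the irrelevant values the solutions form a compact polytope.\<close>

definition zero_indices :: "('i \<Rightarrow> 'w crq) \<Rightarrow> ('i \<Rightarrow> real) \<Rightarrow> 'i set \<Rightarrow> 'i set" where
  "zero_indices F \<mu> I = {i \<in> I. (SUP L\<in>solutions F \<mu> I. cond_mass F I i L) = 0}"

lemma zero_indices_psubset:
  assumes "solutions F \<mu> I \<noteq> {}"
  shows "zero_indices F \<mu> I \<subset> I"
proof -
  let ?C = "constituents F I"
  obtain L where L: "L \<in> solutions F \<mu> I" using assms by blast
  have sum1: "sum L ?C = 1" and nn: "\<And>C. C \<in> ?C \<Longrightarrow> 0 \<le> L C"
    using L by (auto simp: solutions_def)
  have fin: "finite ?C" using sum1 by (metis sum.infinite zero_neq_one)
  obtain C where C: "C \<in> ?C" "L C > 0"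
    using sum1 nn by (metis less_eq_real_def sum.neutral zero_neq_one)
  obtain w where w: "C = {w'. \<forall>E\<in>generating_events F I. w' \<in> E \<longleftrightarrow> w \<in> E}"
    using C(1) by (auto simp: constituents_def atoms_def)
  then obtain i where i: "i \<in> I" "w \<in> cond (F i)"
    using C(1) by (auto simp: constituents_def)
  have "cond (F i) \<in> generating_events F I" using i by (auto simp: generating_events_def)
  then have sub: "C \<subseteq> cond (F i)" using w i by auto
  have "L C \<le> cond_mass F I i L"
    unfolding cond_mass_def using C(1) sub fin nn by (intro member_le_sum) auto
  moreover have "cond_mass F I i L \<le> (SUP L\<in>solutions F \<mu> I. cond_mass F I i L)"
  proof (rule cSUP_upper[OF L])
    have "cond_mass F I i M \<le> 1" if "M \<in> solutions F \<mu> I" for M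
    proof -
      have "cond_mass F I i M \<le> sum M ?C"
        unfolding cond_mass_def using that fin
        by (intro sum_mono2) (auto simp: solutions_def)
      then show ?thesis using that by (simp add: solutions_def)
    qed
    then show "bdd_above (cond_mass F I i ` solutions F \<mu> I)" by (intro bdd_aboveI2[where M = 1])
  qed
  ultimately have "i \<notin> zero_indices F \<mu> I" using C(2) by (auto simp: zero_indices_def)
  then show ?thesis using i(1) by (auto simp: zero_indices_def)
qed

text \<open>For finite index sets the lemma above makes the recursion well founded, so the least fixed
  point below is the only predicate satisfying the recursive characterisation.\<close>

inductive coherent_on :: "('i \<Rightarrow> 'w crq) \<Rightarrow> ('i \<Rightarrow> real) \<Rightarrow> 'i set \<Rightarrow> bool" for F \<mu> where
  "solutions F \<mu> I \<noteq> {} \<Longrightarrow>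
   zero_indices F \<mu> I \<noteq> {} \<longrightarrow> coherent_on F \<mu> (zero_indices F \<mu> I) \<Longrightarrow>
   coherent_on F \<mu> I"

lemma coherent_on_iff:
  "coherent_on F \<mu> I \<longleftrightarrow> solutions F \<mu> I \<noteq> {} \<and>
     (zero_indices F \<mu> I \<noteq> {} \<longrightarrow> coherent_on F \<mu> (zero_indices F \<mu> I))"
  by (subst coherent_on.simps) blast

text \<open>A finite family with its assessment is a list of pairs of a conditional random quantity and
  its prevision.\<close>

definition coherent :: "('w crq \<times> real) list \<Rightarrow> bool" where
  "coherent Fs \<longleftrightarrow> coherent_on (\<lambda>i. fst (Fs ! i)) (\<lambda>i. snd (Fs ! i)) {..<length Fs}"


subsection \<open>Frank t-norms\<close>

definition frank :: "ennreal \<Rightarrow> real \<Rightarrow> real \<Rightarrow> real" where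
  "frank l u v =
     (if l = 0 then min u v
      else if l = 1 then u * v
      else if l = \<infinity> then max (u + v - 1) 0
      else (let r = enn2real l in
              log r (1 + (r powr u - 1) * (r powr v - 1) / (r - 1))))"

end

theory Submission
  imports Defs
begin

text \<open>The conditioning events split \<open>H \<union> K\<close> into exactly six constituents, whatever the values of
  \<open>x\<close>, \<open>y\<close> and \<open>z\<close> are. The linear functionals \<open>z' - y x' - x y' + x y\<close>, \<open>x' - z'\<close> and \<open>y' - z'\<close>
  are nonnegative at the six points, so coherence forces \<open>x y \<le> z \<le> min x y\<close>; conversely, for such
  \<open>z\<close> there are explicit weights giving positive mass to every conditioning event, so that
  \<open>I\<^sub>0\<close> is empty. It remains to see that the Frank t-norms with parameter in \<open>[0, 1]\<close> attain exactly the
  values in \<open>[x y, min x y]\<close>: the bounds come from the concavity of \<open>t powr v\<close>, and a value \<open>z\<close>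
  strictly inside is attained by the intermediate value theorem applied to
  \<open>(1 - r) (1 - r powr z) - (1 - r powr x) (1 - r powr y)\<close>, which behaves like \<open>- r powr z\<close> at
  \<open>0\<close> and like \<open>(z - x y) (1 - r)\<^sup>2\<close> at \<open>1\<close>.\<close>

subsection \<open>Coherence of the conjunction\<close>

text \<open>One good solution stops the recursion at its first stage. Conditional masses never
  exceed the total mass 1, so the supremum in \<open>zero_indices\<close> is over a bounded set and
  is at least the mass given by \<open>L\<close>.\<close>

lemma coherent_onI_cond_mass_pos:
  assumes L: "L \<in> solutions F \<mu> I" and pos: "\<And>i. i \<in> I \<Longrightarrow> 0 < cond_mass F I i L"
  shows "coherent_on F \<mu> I"
proof -
  have "(SUP L\<in>solutions F \<mu> I. cond_mass F I i L) > 0" if "i \<in> I" for i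
  proof -
    have "sum L (constituents F I) = 1" using L by (simp add: solutions_def)
    \<comment> \<open>A sum over an infinite set is 0 by convention, so total mass 1 forces
      finiteness.\<close>
    then have fin: "finite (constituents F I)" by (metis sum.infinite zero_neq_one)
    have "cond_mass F I i M \<le> 1" if M: "M \<in> solutions F \<mu> I" for M
    proof -
      have "cond_mass F I i M \<le> sum M (constituents F I)"
        unfolding cond_mass_def using M fin by (intro sum_mono2) (auto simp: solutions_def)
      then show ?thesis using M by (simp add: solutions_def)
    qed
    then have "bdd_above (cond_mass F I i ` solutions F \<mu> I)"
      by (intro bdd_aboveI2[where M = 1])
    then have "cond_mass F I i L \<le> (SUP L\<in>solutions F \<mu> I. cond_mass F I i L)"
      by (rule cSUP_upper[OF L])
    then show ?thesis using pos[OF that] by linarith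
  qed
  then have "zero_indices F \<mu> I = {}" by (fastforce simp: zero_indices_def)
  then show ?thesis using L by (subst coherent_on_iff) auto
qed

lemma point_inside:
  assumes "w \<in> C" "C \<subseteq> cond (F i)" "\<And>w'. w' \<in> C \<Longrightarrow> rq (F i) w' = v"
  shows "point F \<mu> C i = v"
proof -
  have "rq (F i) ` C = {v}" using assms by auto
  then show ?thesis using assms by (simp add: point_def)
qed

lemma point_outside:
  assumes "w \<in> C" "w \<notin> cond (F i)"
  shows "point F \<mu> C i = \<mu> i"
  using assms by (auto simp: point_def)

lemma logically_independent_nonempty:
  assumes "logically_independent [A, H, K]"
    and "A' \<in> {A, - A}" "H' \<in> {H, - H}" "K' \<in> {K, - K}"
  obtains w where "w \<in> A' \<inter> H' \<inter> K'"
proof -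
  have "list_all2 (\<lambda>F E. F \<in> {E, - E}) [A', H', K'] [A, H, K]" using assms(2-) by simp
  then have "\<Inter> (set [A', H', K']) \<noteq> {}" using assms(1) unfolding logically_independent_def by blast
  then show thesis using that by auto
qed

text \<open>Replaces the generating events, indexed by all real \<open>v\<close>, by one condition
  per index: the choice \<open>v = rq (F i) w\<close> already separates outcomes with different
  values.\<close>

lemma atom_generating_events:
  "{w'. \<forall>E\<in>generating_events F I. w' \<in> E \<longleftrightarrow> w \<in> E} =
    {w'. \<forall>i\<in>I. (w' \<in> cond (F i) \<longleftrightarrow> w \<in> cond (F i)) \<and>
      (w \<in> cond (F i) \<longrightarrow> rq (F i) w' = rq (F i) w)}"
  (is "?L = ?R")
proof (intro set_eqI iffI)
  fix w' assume w': "w' \<in> ?L"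
  show "w' \<in> ?R"
    unfolding mem_Collect_eq
  proof (intro ballI)
    fix i assume i: "i \<in> I"
    then have "cond (F i) \<in> generating_events F I"
      and "{u. rq (F i) u = rq (F i) w} \<inter> cond (F i) \<in> generating_events F I"
      unfolding generating_events_def by blast+
    note this[THEN bspec[OF w'[unfolded mem_Collect_eq]]]
    then show "(w' \<in> cond (F i) \<longleftrightarrow> w \<in> cond (F i)) \<and>
        (w \<in> cond (F i) \<longrightarrow> rq (F i) w' = rq (F i) w)"
      by auto
  qed
next
  fix w' assume w': "w' \<in> ?R"
  show "w' \<in> ?L"
    unfolding mem_Collect_eq
  proof (intro ballI)
    fix E assume "E \<in> generating_events F I"
    then obtain i v where i: "i \<in> I"
      and "E = cond (F i) \<or> E = {u. rq (F i) u = v} \<inter> cond (F i)"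
      unfolding generating_events_def by blast
    moreover have "(w' \<in> cond (F i) \<longleftrightarrow> w \<in> cond (F i)) \<and>
        (w \<in> cond (F i) \<longrightarrow> rq (F i) w' = rq (F i) w)"
      using w' i by simp
    ultimately show "w' \<in> E \<longleftrightarrow> w \<in> E" by auto
  qed
qed

section \<open>Weights on the six points\<close>

lemma conjunction_weights_bounds:
  fixes x y z :: real
  assumes x: "0 \<le> x" "x \<le> 1" and y: "0 \<le> y" "y \<le> 1"
    and nn: "0 \<le> l1" "0 \<le> l2" "0 \<le> l3" "0 \<le> l4" "0 \<le> l5" "0 \<le> l6"
    and s: "l1 + l2 + l3 + l4 + l5 + l6 = 1"
    and ex: "l1 + l3 + l5 * x + l6 * x = x"
    and ey: "l1 + l3 * y + l4 * y + l5 = y"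
    and ez: "l1 + l3 * y + l5 * x = z"
  shows "x * y \<le> z" "z \<le> min x y"
proof -
  \<comment> \<open>The functional \<open>z' - y x' - x y' + x y\<close> vanishes at the four points
    where only one of \<open>H\<close>, \<open>K\<close> is true, so only \<open>l1\<close> and
    \<open>l2\<close> survive.\<close>
  have "z - x * y = l1 * ((1 - x) * (1 - y)) + l2 * (x * y)"
  proof -
    have "y * (l1 + l3 + l5 * x + l6 * x) = x * y" "x * (l1 + l3 * y + l4 * y + l5) = x * y"
      "x * y * (l1 + l2 + l3 + l4 + l5 + l6) = x * y"
      unfolding s ex ey by simp_all
    then show ?thesis using ez by (simp add: algebra_simps)
  qed
  moreover have "0 \<le> l1 * ((1 - x) * (1 - y)) + l2 * (x * y)" using nn x y by simp
  ultimately show "x * y \<le> z" by simp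
  have "x - z = l3 * (1 - y) + l6 * x" using ex ez by (simp add: algebra_simps)
  moreover have "0 \<le> l3 * (1 - y) + l6 * x" using nn x y by simp
  ultimately have "z \<le> x" by simp
  have "y - z = l4 * y + l5 * (1 - x)" using ey ez by (simp add: algebra_simps)
  moreover have "0 \<le> l4 * y + l5 * (1 - x)" using nn x y by simp
  ultimately have "z \<le> y" by simp
  with \<open>z \<le> x\<close> show "z \<le> min x y" by simp
qed

lemma conjunction_weights_exist:
  fixes x y z :: real
  assumes x: "0 \<le> x" "x \<le> 1" and y: "0 \<le> y" "y \<le> 1" and z: "x * y \<le> z" "z \<le> min x y"
  obtains l1 l2 l3 l4 l5 l6 :: real where
    "0 \<le> l1" "0 \<le> l2" "0 \<le> l3" "0 \<le> l4" "0 \<le> l5" "0 \<le> l6"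
    "l1 + l2 + l3 + l4 + l5 + l6 = 1"
    "l1 + l3 + l5 * x + l6 * x = x"
    "l1 + l3 * y + l4 * y + l5 = y"
    "l1 + l3 * y + l5 * x = z"
    "0 < l1 + l2 + l3 + l4" "0 < l1 + l2 + l5 + l6"
proof (cases "z = x * y")
  case True
  \<comment> \<open>No mass on \<open>H \<inter> K\<close> yields exactly \<open>z = x * y\<close>.
    Half the mass goes outside \<open>K\<close> and half outside \<open>H\<close>, which keeps both
    conditioning events positive; the construction of the other case would have \<open>v = 0\<close>
    and leave \<open>H\<close> without mass.\<close>
  show thesis
    by (rule that[of 0 0 "x / 2" "(1 - x) / 2" "y / 2" "(1 - y) / 2"])
      (use x y True in \<open>auto simp: field_simps\<close>)
next
  case False
  then have less: "x * y < z" using z by simp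
  \<comment> \<open>At \<open>x = 0\<close> or \<open>x = 1\<close> the bounds \<open>x * y\<close>
    and \<open>min x y\<close> coincide, contradicting strictness.\<close>
  have x': "0 < x" "x < 1" using less z x y by (auto simp: less_le)
  txt \<open>Put mass \<open>v\<close> on \<open>H \<inter> K\<close>, divided in the ratio \<open>x : 1 - x\<close> between \<open>A\<close> and \<open>- A\<close>, and the
    rest on \<open>- H \<inter> K\<close>. The equation for \<open>x\<close> then holds for every \<open>v\<close>, the one for \<open>y\<close> determines the
    remaining weights, and the one for \<open>z\<close> determines \<open>v\<close>.\<close>
  define v where "v = (z - x * y) / (x * (1 - x))"
  have v: "0 < v" "v * (x * (1 - x)) = z - x * y" using less x' by (auto simp: v_def)
  \<comment> \<open>These are \<open>z \<le> y\<close> and \<open>z \<le> x\<close> in terms of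
    \<open>v\<close>; they make the last two weights nonnegative.\<close>
  have "v * x * (1 - x) \<le> y * (1 - x)" "v * (1 - x) * x \<le> (1 - y) * x"
    using v(2) z by (simp_all add: algebra_simps)
  then have "v * x \<le> y" "v * (1 - x) \<le> 1 - y" using x' by auto
  then show thesis
    using x' v y by (intro that[of "v * x" "v * (1 - x)" 0 0 "y - v * x" "1 - y - v * (1 - x)"])
      (auto simp: algebra_simps intro: add_pos_nonneg)
qed

section \<open>The six constituents and their points\<close>

locale conjunction_assessment =
  fixes A H K :: "'w set" and x y z :: real and F :: "nat \<Rightarrow> 'w crq" and \<mu> :: "nat \<Rightarrow> real"
  assumes ind: "logically_independent [A, H, K]"
    and F: "F 0 = cond_event A H x" "F 1 = cond_event A K y" "F 2 = conjunction A H K x y z"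
    and \<mu>: "\<mu> 0 = x" "\<mu> 1 = y" "\<mu> 2 = z"
begin

lemma conds: "cond (F 0) = H" "cond (F 1) = K" "cond (F 2) = H \<union> K"
  by (simp_all add: F cond_event_def conjunction_def del: One_nat_def)

text \<open>Coincidences among 0, 1, \<open>x\<close>, \<open>y\<close>, \<open>z\<close> do not
  matter: the values 1 and 0 of \<open>A|H\<close> and \<open>A|K\<close> already separate
  \<open>A\<close> from its complement inside \<open>H \<union> K\<close>, and there the conjunction
  depends only on the truth of \<open>A\<close>, \<open>H\<close>, \<open>K\<close>.\<close>

lemma atom_containing:
  "{w'. \<forall>E\<in>generating_events F {0, 1, 2}. w' \<in> E \<longleftrightarrow> w \<in> E} =
    {w'. (w' \<in> H \<longleftrightarrow> w \<in> H) \<and> (w' \<in> K \<longleftrightarrow> w \<in> K) \<and> (w' \<in> A \<inter> (H \<union> K) \<longleftrightarrow> w \<in> A \<inter> (H \<union> K))}"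
  unfolding atom_generating_events ball_simps conds F
  by (rule Collect_cong, cases "w \<in> A"; cases "w \<in> H"; cases "w \<in> K")
    (auto simp: cond_event_def conjunction_def)

lemma constituents_eq:
  "constituents F {0, 1, 2} =
    {A \<inter> H \<inter> K, - A \<inter> H \<inter> K, A \<inter> H \<inter> - K, - A \<inter> H \<inter> - K, A \<inter> - H \<inter> K, - A \<inter> - H \<inter> K}"
proof -
  let ?R = "\<lambda>w. {w'. (w' \<in> H \<longleftrightarrow> w \<in> H) \<and> (w' \<in> K \<longleftrightarrow> w \<in> K) \<and>
    (w' \<in> A \<inter> (H \<union> K) \<longleftrightarrow> w \<in> A \<inter> (H \<union> K))}"
  have U: "(\<Union>i\<in>{0, 1, 2}. cond (F i)) = H \<union> K"
    by (auto simp: conds simp del: One_nat_def)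
  have "constituents F {0, 1, 2} = {C \<in> range ?R. C \<subseteq> H \<union> K}"
    unfolding constituents_def atoms_def U atom_containing ..
  also have "\<dots> = ?R ` (H \<union> K)" by auto
  also have "\<dots> = {A \<inter> H \<inter> K, - A \<inter> H \<inter> K, A \<inter> H \<inter> - K, - A \<inter> H \<inter> - K, A \<inter> - H \<inter> K, - A \<inter> - H \<inter> K}"
    (is "_ = ?S")
  proof
    show "?R ` (H \<union> K) \<subseteq> ?S"
    proof (rule image_subsetI)
      fix w assume "w \<in> H \<union> K"
      then consider "w \<in> A" "w \<in> H" "w \<in> K" | "w \<notin> A" "w \<in> H" "w \<in> K"
        | "w \<in> A" "w \<in> H" "w \<notin> K" | "w \<notin> A" "w \<in> H" "w \<notin> K"
        | "w \<in> A" "w \<notin> H" "w \<in> K" | "w \<notin> A" "w \<notin> H" "w \<in> K" by blast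
      then show "?R w \<in> ?S"
      proof cases
        case 1
        then have "?R w = A \<inter> H \<inter> K" by auto
        then show ?thesis by (simp only: insert_iff simp_thms)
      next
        case 2
        then have "?R w = - A \<inter> H \<inter> K" by auto
        then show ?thesis by (simp only: insert_iff simp_thms)
      next
        case 3
        then have "?R w = A \<inter> H \<inter> - K" by auto
        then show ?thesis by (simp only: insert_iff simp_thms)
      next
        case 4
        then have "?R w = - A \<inter> H \<inter> - K" by auto
        then show ?thesis by (simp only: insert_iff simp_thms)
      next
        case 5
        then have "?R w = A \<inter> - H \<inter> K" by auto
        then show ?thesis by (simp only: insert_iff simp_thms)
      next
        case 6
        then have "?R w = - A \<inter> - H \<inter> K" by auto
        then show ?thesis by (simp only: insert_iff simp_thms)
      qed
    qed
    \<comment> \<open>Logical independence supplies a representative of each candidate; the last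
      premise keeps it inside \<open>H \<union> K\<close>.\<close>
    have classes: "A' \<inter> H' \<inter> K' \<in> ?R ` (H \<union> K)"
      if S: "A' \<in> {A, - A}" "H' \<in> {H, - H}" "K' \<in> {K, - K}" "H' = H \<or> K' = K" for A' H' K'
    proof -
      obtain w where w: "w \<in> A' \<inter> H' \<inter> K'"
        using logically_independent_nonempty[OF ind S(1-3)] .
      then have "A' \<inter> H' \<inter> K' = ?R w" and "w \<in> H \<union> K" using S by auto
      then show ?thesis by (rule image_eqI)
    qed
    show "?S \<subseteq> ?R ` (H \<union> K)"
      unfolding insert_subset by (intro conjI classes empty_subsetI) simp_all
  qed
  finally show ?thesis .
qed

text \<open>The six sets are disjoint, so nonemptiness makes them distinct and no term is lost when
  sums are expanded.\<close>

lemma distinct_constituents: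
  "distinct [A \<inter> H \<inter> K, - A \<inter> H \<inter> K, A \<inter> H \<inter> - K, - A \<inter> H \<inter> - K, A \<inter> - H \<inter> K, - A \<inter> - H \<inter> K]"
proof -
  note N = logically_independent_nonempty[OF ind]
  obtain w1 where w1: "w1 \<in> A \<inter> H \<inter> K" using N[of A H K] by blast
  obtain w2 where w2: "w2 \<in> - A \<inter> H \<inter> K" using N[of "- A" H K] by blast
  obtain w3 where w3: "w3 \<in> A \<inter> H \<inter> - K" using N[of A H "- K"] by blast
  obtain w4 where w4: "w4 \<in> - A \<inter> H \<inter> - K" using N[of "- A" H "- K"] by blast
  obtain w5 where w5: "w5 \<in> A \<inter> - H \<inter> K" using N[of A "- H" K] by blast
  obtain w6 where w6: "w6 \<in> - A \<inter> - H \<inter> K" using N[of "- A" "- H" K] by blast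
  show ?thesis
    using w1 w2 w3 w4 w5 w6 unfolding distinct.simps list.set by blast
qed

lemma sum_constituents:
  fixes f :: "'w set \<Rightarrow> real"
  shows "sum f (constituents F {0, 1, 2}) =
    f (A \<inter> H \<inter> K) + f (- A \<inter> H \<inter> K) + f (A \<inter> H \<inter> - K) + f (- A \<inter> H \<inter> - K) +
    f (A \<inter> - H \<inter> K) + f (- A \<inter> - H \<inter> K)"
  using distinct_constituents unfolding constituents_eq by (simp add: add.assoc)

text \<open>Every constituent lies in \<open>H \<union> K\<close>, so the third coordinate is never
  the default \<open>z\<close>; thus \<open>z\<close> enters only through the right-hand side of its
  barycentre equation.\<close>

lemma points:
  "map (point F \<mu> (A \<inter> H \<inter> K)) [0, 1, 2] = [1, 1, 1]"
  "map (point F \<mu> (- A \<inter> H \<inter> K)) [0, 1, 2] = [0, 0, 0]"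
  "map (point F \<mu> (A \<inter> H \<inter> - K)) [0, 1, 2] = [1, y, y]"
  "map (point F \<mu> (- A \<inter> H \<inter> - K)) [0, 1, 2] = [0, y, 0]"
  "map (point F \<mu> (A \<inter> - H \<inter> K)) [0, 1, 2] = [x, 1, x]"
  "map (point F \<mu> (- A \<inter> - H \<inter> K)) [0, 1, 2] = [x, 0, 0]"
proof -
  note N = logically_independent_nonempty[OF ind]
  note d = F F(2)[unfolded One_nat_def] cond_event_def conjunction_def
  obtain w where w: "w \<in> A \<inter> H \<inter> K" using N[of A H K] by blast
  show "map (point F \<mu> (A \<inter> H \<inter> K)) [0, 1, 2] = [1, 1, 1]"
    unfolding list.map list.inject by (intro conjI point_inside[OF w] refl) (auto simp: d)
  obtain w where w: "w \<in> - A \<inter> H \<inter> K" using N[of "- A" H K] by blast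
  show "map (point F \<mu> (- A \<inter> H \<inter> K)) [0, 1, 2] = [0, 0, 0]"
    unfolding list.map list.inject by (intro conjI point_inside[OF w] refl) (auto simp: d)
  obtain w where w: "w \<in> A \<inter> H \<inter> - K" using N[of A H "- K"] by blast
  show "map (point F \<mu> (A \<inter> H \<inter> - K)) [0, 1, 2] = [1, y, y]"
    unfolding list.map list.inject
    by (intro conjI refl point_inside[OF w] point_outside[OF w, of F 1 \<mu>, unfolded \<mu>])
      (use w in \<open>auto simp: d\<close>)
  obtain w where w: "w \<in> - A \<inter> H \<inter> - K" using N[of "- A" H "- K"] by blast
  show "map (point F \<mu> (- A \<inter> H \<inter> - K)) [0, 1, 2] = [0, y, 0]"
    unfolding list.map list.inject
    by (intro conjI refl point_inside[OF w, of F 0] point_inside[OF w, of F 2]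
        point_outside[OF w, of F 1 \<mu>, unfolded \<mu>]) (use w in \<open>auto simp: d\<close>)
  obtain w where w: "w \<in> A \<inter> - H \<inter> K" using N[of A "- H" K] by blast
  show "map (point F \<mu> (A \<inter> - H \<inter> K)) [0, 1, 2] = [x, 1, x]"
    unfolding list.map list.inject
    by (intro conjI refl point_inside[OF w, of F 1] point_inside[OF w, of F 2]
        point_outside[OF w, of F 0 \<mu>, unfolded \<mu>]) (use w in \<open>auto simp: d\<close>)
  obtain w where w: "w \<in> - A \<inter> - H \<inter> K" using N[of "- A" "- H" K] by blast
  show "map (point F \<mu> (- A \<inter> - H \<inter> K)) [0, 1, 2] = [x, 0, 0]"
    unfolding list.map list.inject
    by (intro conjI refl point_inside[OF w, of F 1] point_inside[OF w, of F 2]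
        point_outside[OF w, of F 0 \<mu>, unfolded \<mu>]) (use w in \<open>auto simp: d\<close>)
qed

lemma coherent_iff:
  assumes x: "0 \<le> x" "x \<le> 1" and y: "0 \<le> y" "y \<le> 1"
  shows "coherent_on F \<mu> {0, 1, 2} \<longleftrightarrow> x * y \<le> z \<and> z \<le> min x y"
proof -
  let ?C1 = "A \<inter> H \<inter> K" and ?C2 = "- A \<inter> H \<inter> K" and ?C3 = "A \<inter> H \<inter> - K"
    and ?C4 = "- A \<inter> H \<inter> - K" and ?C5 = "A \<inter> - H \<inter> K" and ?C6 = "- A \<inter> - H \<inter> K"
  have solutions: "L \<in> solutions F \<mu> {0, 1, 2} \<longleftrightarrow>
    (0 \<le> L ?C1 \<and> 0 \<le> L ?C2 \<and> 0 \<le> L ?C3 \<and> 0 \<le> L ?C4 \<and> 0 \<le> L ?C5 \<and> 0 \<le> L ?C6) \<and>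
    L ?C1 + L ?C2 + L ?C3 + L ?C4 + L ?C5 + L ?C6 = 1 \<and>
    L ?C1 + L ?C3 + L ?C5 * x + L ?C6 * x = x \<and>
    L ?C1 + L ?C3 * y + L ?C4 * y + L ?C5 = y \<and>
    L ?C1 + L ?C3 * y + L ?C5 * x = z" for L
    using points \<mu> unfolding solutions_def mem_Collect_eq sum_constituents
    by (simp add: constituents_eq[unfolded One_nat_def])
  show ?thesis
  proof
    assume "coherent_on F \<mu> {0, 1, 2}"
    then obtain L where L: "L \<in> solutions F \<mu> {0, 1, 2}" by (subst (asm) coherent_on_iff) blast
    then have nn: "0 \<le> L ?C1" "0 \<le> L ?C2" "0 \<le> L ?C3" "0 \<le> L ?C4" "0 \<le> L ?C5" "0 \<le> L ?C6"
      and s: "L ?C1 + L ?C2 + L ?C3 + L ?C4 + L ?C5 + L ?C6 = 1"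
      and ex: "L ?C1 + L ?C3 + L ?C5 * x + L ?C6 * x = x"
      and ey: "L ?C1 + L ?C3 * y + L ?C4 * y + L ?C5 = y"
      and ez: "L ?C1 + L ?C3 * y + L ?C5 * x = z" unfolding solutions by auto
    show "x * y \<le> z \<and> z \<le> min x y"
      using conjunction_weights_bounds[OF x y nn s ex ey ez] by simp
  next
    assume "x * y \<le> z \<and> z \<le> min x y"
    then have z: "x * y \<le> z" "z \<le> min x y" by auto
    obtain l1 l2 l3 l4 l5 l6 where l: "0 \<le> l1" "0 \<le> l2" "0 \<le> l3" "0 \<le> l4" "0 \<le> l5" "0 \<le> l6"
      "l1 + l2 + l3 + l4 + l5 + l6 = 1"
      "l1 + l3 + l5 * x + l6 * x = x"
      "l1 + l3 * y + l4 * y + l5 = y"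
      "l1 + l3 * y + l5 * x = z"
      and pos: "0 < l1 + l2 + l3 + l4" "0 < l1 + l2 + l5 + l6"
      by (rule conjunction_weights_exist[OF x y z])
    define L where "L C = (if C = ?C1 then l1 else if C = ?C2 then l2 else if C = ?C3 then l3
      else if C = ?C4 then l4 else if C = ?C5 then l5 else l6)" for C
    have L: "L ?C1 = l1" "L ?C2 = l2" "L ?C3 = l3" "L ?C4 = l4" "L ?C5 = l5" "L ?C6 = l6"
      using distinct_constituents
      by (simp_all only: L_def distinct.simps list.set insert_iff empty_iff de_Morgan_disj
          simp_thms if_True if_False
          not_sym[of ?C1] not_sym[of ?C2] not_sym[of ?C3] not_sym[of ?C4] not_sym[of ?C5])
    have "L \<in> solutions F \<mu> {0, 1, 2}" unfolding solutions L using l by simp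
    then show "coherent_on F \<mu> {0, 1, 2}"
    proof (rule coherent_onI_cond_mass_pos)
      fix i :: nat assume i: "i \<in> {0, 1, 2}"
      have "finite (constituents F {0, 1, 2})" unfolding constituents_eq by simp
      then have mass: "cond_mass F {0, 1, 2} i L =
          (\<Sum>C\<in>constituents F {0, 1, 2}. if C \<subseteq> cond (F i) then L C else 0)"
        unfolding cond_mass_def by (rule sum.inter_filter)
      have sub: "?C1 \<subseteq> H" "?C2 \<subseteq> H" "?C3 \<subseteq> H" "?C4 \<subseteq> H"
        "?C1 \<subseteq> K" "?C2 \<subseteq> K" "?C5 \<subseteq> K" "?C6 \<subseteq> K"
        "?C1 \<subseteq> H \<union> K" "?C2 \<subseteq> H \<union> K" "?C3 \<subseteq> H \<union> K" "?C4 \<subseteq> H \<union> K"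
        by blast+
      \<comment> \<open>The remaining terms are nonnegative either way, so their inclusions need not
        be decided.\<close>
      have nn: "0 \<le> (if P then l else 0)" if "0 \<le> l" for P and l :: real using that by simp
      from i consider "i = 0" | "i = 1" | "i = 2" by blast
      then have "l1 + l2 + l3 + l4 \<le> cond_mass F {0, 1, 2} i L \<or>
        l1 + l2 + l5 + l6 \<le> cond_mass F {0, 1, 2} i L"
      proof cases
        case 1
        have "l1 + l2 + l3 + l4 \<le> cond_mass F {0, 1, 2} i L"
          unfolding mass unfolding 1 sum_constituents L conds
          using nn[OF l(5), of "?C5 \<subseteq> H"] nn[OF l(6), of "?C6 \<subseteq> H"]
          by (simp only: sub if_True)
        then show ?thesis ..
      next
        case 2
        have "l1 + l2 + l5 + l6 \<le> cond_mass F {0, 1, 2} i L"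
          unfolding mass unfolding 2 sum_constituents L conds
          using nn[OF l(3), of "?C3 \<subseteq> K"] nn[OF l(4), of "?C4 \<subseteq> K"]
          by (simp only: sub if_True)
        then show ?thesis ..
      next
        case 3
        have "l1 + l2 + l3 + l4 \<le> cond_mass F {0, 1, 2} i L"
          unfolding mass unfolding 3 sum_constituents L conds
          using nn[OF l(5), of "?C5 \<subseteq> H \<union> K"] nn[OF l(6), of "?C6 \<subseteq> H \<union> K"]
          by (simp only: sub if_True)
        then show ?thesis ..
      qed
      then show "0 < cond_mass F {0, 1, 2} i L" using pos by linarith
    qed
  qed
qed

end

subsection \<open>Values of Frank t-norms\<close>

lemma powr_concave:
  fixes p :: real
  assumes "0 \<le> p" "p \<le> 1"
  shows "concave_on {0<..} (\<lambda>t. t powr p)"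
proof (rule f''_le0_imp_concave)
  show "((\<lambda>t. t powr p) has_real_derivative p * t powr (p - 1)) (at t)" if "t \<in> {0<..}" for t
    using that by (auto intro!: derivative_eq_intros)
  show "((\<lambda>t. p * t powr (p - 1)) has_real_derivative p * ((p - 1) * t powr (p - 1 - 1))) (at t)"
    if "t \<in> {0<..}" for t
    using that by (auto intro!: derivative_eq_intros)
  show "p * ((p - 1) * t powr (p - 1 - 1)) \<le> 0" for t
    using assms by (simp add: mult_nonneg_nonpos mult_nonpos_nonneg)
qed auto

text \<open>The middle term is \<open>1 - (1 - r powr u) * c\<close>, with \<open>c\<close> the
  quotient for \<open>v\<close>. The lower bound is \<open>c \<le> 1\<close>. For the upper one,
  \<open>r powr u\<close> is the convex combination of 1 and \<open>r\<close> with weight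
  \<open>t\<close> on \<open>r\<close>, and the concave map \<open>s powr v\<close> lies above its
  chord.\<close>

lemma powr_frank_argument_bounds:
  fixes r u v :: real
  assumes r: "0 < r" "r < 1" and u: "0 \<le> u" "u \<le> 1" and v: "0 \<le> v" "v \<le> 1"
  shows "r powr u \<le> 1 + (r powr u - 1) * (r powr v - 1) / (r - 1)"
    and "1 + (r powr u - 1) * (r powr v - 1) / (r - 1) \<le> r powr (u * v)"
proof -
  have ru: "r \<le> r powr u" "r powr u \<le> 1" and rv: "r \<le> r powr v"
    using powr_mono'[of u 1 r] powr_mono'[of v 1 r] powr_le1[of u r] r u v by auto
  define c where "c = (1 - r powr v) / (1 - r)"
  have D: "1 + (r powr u - 1) * (r powr v - 1) / (r - 1) = 1 - (1 - r powr u) * c"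
    using r by (simp add: c_def divide_simps) (simp add: algebra_simps)
  have "c \<le> 1" using r rv by (simp add: c_def)
  then have "(1 - r powr u) * c \<le> (1 - r powr u) * 1" using ru by (intro mult_left_mono) auto
  then show "r powr u \<le> 1 + (r powr u - 1) * (r powr v - 1) / (r - 1)" unfolding D by simp
  define t where "t = (1 - r powr u) / (1 - r)"
  have t: "0 \<le> t" "t \<le> 1" using ru r by (auto simp: t_def)
  have c: "(1 - r) * c = 1 - r powr v" and tr: "t * (1 - r) = 1 - r powr u"
    using r by (auto simp: c_def t_def)
  have "r powr u = (1 - t) * 1 + t * r" using tr by (simp add: algebra_simps)
  moreover have "(1 - t) * 1 powr v + t * r powr v \<le> ((1 - t) * 1 + t * r) powr v"
    using concave_onD[OF powr_concave[OF v], of t 1 r] t r by simp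
  ultimately have "(1 - t) + t * r powr v \<le> (r powr u) powr v" by simp
  moreover have "(1 - r powr u) * c = t * (1 - r powr v)"
    unfolding tr[symmetric] c[symmetric] by simp
  ultimately show "1 + (r powr u - 1) * (r powr v - 1) / (r - 1) \<le> r powr (u * v)"
    unfolding D by (simp add: algebra_simps powr_powr)
qed

text \<open>The logarithm to a base below 1 reverses the bounds on its argument; symmetry in
  \<open>u\<close> and \<open>v\<close> supplies the second half of the minimum.\<close>

lemma log_frank_argument_bounds:
  fixes r u v :: real
  assumes r: "0 < r" "r < 1" and u: "0 \<le> u" "u \<le> 1" and v: "0 \<le> v" "v \<le> 1"
  shows "log r (1 + (r powr u - 1) * (r powr v - 1) / (r - 1)) \<in> {u * v..min u v}"
proof -
  define D where "D = 1 + (r powr u - 1) * (r powr v - 1) / (r - 1)"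
  have D1: "r powr u \<le> D" "D \<le> r powr (u * v)"
    using powr_frank_argument_bounds[OF assms] by (auto simp: D_def)
  have D2: "r powr v \<le> D"
    using powr_frank_argument_bounds(1)[OF r v u] by (simp add: D_def mult.commute)
  have pos: "0 < D" using D1(1) r by (smt (verit) powr_gt_zero)
  have neg: "ln r < 0" using r by simp
  have "ln (r powr u) \<le> ln D" "ln (r powr v) \<le> ln D" "ln D \<le> ln (r powr (u * v))"
    using D1 D2 pos r by (auto simp del: ln_powr)
  then have "u * ln r \<le> ln D" "v * ln r \<le> ln D" "ln D \<le> u * v * ln r"
    using r by auto
  then show ?thesis
    using neg unfolding D_def[symmetric] by (auto simp: log_def neg_divide_le_eq neg_le_divide_eq)
qed

lemma enn2real_unit_interval:
  fixes l :: ennreal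
  assumes "l \<le> 1" "l \<noteq> 0" "l \<noteq> 1"
  shows "0 < enn2real l" "enn2real l < 1" "l \<noteq> \<infinity>"
  using assms by (cases l; auto simp: top_unique)+

lemma frank_bounds:
  assumes "l \<le> 1" "0 \<le> u" "u \<le> 1" "0 \<le> v" "v \<le> 1"
  shows "u * v \<le> frank l u v" "frank l u v \<le> min u v"
proof -
  have *: "u * v \<le> min u v" using assms by (simp add: mult_left_le mult_left_le_one_le)
  have "frank l u v \<in> {u * v..min u v}"
  proof (cases "l = 0 \<or> l = 1")
    case True
    then show ?thesis using * by (auto simp: frank_def)
  next
    case False
    then show ?thesis
      using log_frank_argument_bounds[of "enn2real l" u v] enn2real_unit_interval[of l] assms
      by (simp add: frank_def Let_def)
  qed
  then show "u * v \<le> frank l u v" "frank l u v \<le> min u v" by auto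
qed

text \<open>When one argument is 0 or 1, product and minimum agree and squeeze the value.\<close>

lemma frank_boundary:
  assumes "l \<le> 1" "0 \<le> u" "u \<le> 1"
  shows "frank l 0 u = 0" "frank l u 0 = 0" "frank l 1 u = u" "frank l u 1 = u"
  using frank_bounds[of l 0 u] frank_bounds[of l u 0] frank_bounds[of l 1 u] frank_bounds[of l u 1]
    assms by (auto simp: min_def split: if_splits)

section \<open>Every value between product and minimum is attained\<close>

lemma powr_base_tendsto_0:
  assumes "0 < (a :: real)"
  shows "((\<lambda>r. r powr a) \<longlongrightarrow> 0) (at_right 0)"
proof -
  have "((\<lambda>r. r powr a) \<longlongrightarrow> 0 powr a) (at_right (0 :: real))"
    using assms by (intro tendsto_powr' tendsto_intros)
      (auto simp: eventually_at_filter)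
  then show ?thesis using assms by simp
qed

lemma powr_difference_quotient_at_1:
  "((\<lambda>r. (1 - r powr a) / (1 - r)) \<longlongrightarrow> a) (at_left (1 :: real))"
proof -
  have "((\<lambda>r. r powr a) has_real_derivative a) (at 1)"
    by (auto intro!: derivative_eq_intros)
  then have "((\<lambda>r. (r powr a - 1) / (r - 1)) \<longlongrightarrow> a) (at (1 :: real))"
    by (simp add: has_field_derivative_iff)
  moreover have "(r powr a - 1) / (r - 1) = (1 - r powr a) / (1 - r)" for r :: real
    by (metis minus_diff_eq minus_divide_divide)
  ultimately show ?thesis
    using tendsto_mono[OF at_le[OF subset_UNIV]] by simp
qed

lemma frank_surj:
  assumes x: "0 \<le> x" "x \<le> 1" and y: "0 \<le> y" "y \<le> 1" and z: "x * y \<le> z" "z \<le> min x y"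
  obtains l where "l \<le> 1" "z = frank l x y"
proof -
  consider "z = min x y" | "z = x * y" | "x * y < z" "z < x" "z < y" using z by linarith
  then show thesis
  proof cases
    case 1
    then show thesis by (intro that[of 0]) (auto simp: frank_def)
  next
    case 2
    then show thesis by (intro that[of 1]) (auto simp: frank_def)
  next
    case 3
    have z0: "0 < z" using 3(1) x y by (smt (verit) mult_nonneg_nonneg)
    have z1: "z < 1" using 3 x by simp
    \<comment> \<open>For \<open>0 < r < 1\<close>, clearing the denominator \<open>1 - r\<close>
      shows that \<open>g r = 0\<close> says exactly that the Frank t-norm with parameter
      \<open>r\<close> takes the value \<open>z\<close>.\<close>
    define g :: "real \<Rightarrow> real"
      where "g r = (1 - r) * (1 - r powr z) - (1 - r powr x) * (1 - r powr y)" for r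
    \<comment> \<open>This is \<open>g r / r powr z\<close> expanded. All exponents are positive
      because \<open>0 < z\<close>, \<open>z < min x y\<close> and \<open>z < 1\<close>, so only the
      constant -1 survives at 0.\<close>
    have "((\<lambda>r. r powr (x - z) + r powr (y - z) - r powr (x + y - z) + r - r powr (1 - z) - 1)
        \<longlongrightarrow> 0 + 0 - 0 + 0 - 0 - 1) (at_right 0)"
      using 3 z0 z1 by (intro tendsto_intros powr_base_tendsto_0) auto
    then have "\<forall>\<^sub>F r in at_right 0.
        r powr (x - z) + r powr (y - z) - r powr (x + y - z) + r - r powr (1 - z) - 1 < 0"
      by (rule order_tendstoD) simp
    moreover have "\<forall>\<^sub>F r in at_right 0. (0 :: real) < r \<and> r < 1"
      using eventually_at_right_real[of 0 1] by simp
    ultimately have "\<forall>\<^sub>F r in at_right 0. (0 < r \<and> r < 1) \<and>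
        r powr (x - z) + r powr (y - z) - r powr (x + y - z) + r - r powr (1 - z) - 1 < 0"
      by (rule eventually_conj[rotated])
    then obtain a where a: "0 < a" "a < 1"
      "a powr (x - z) + a powr (y - z) - a powr (x + y - z) + a - a powr (1 - z) - 1 < 0"
      using eventually_happens'[OF trivial_limit_at_right_real] by blast
    have "g a = a powr z *
        (a powr (x - z) + a powr (y - z) - a powr (x + y - z) + a - a powr (1 - z) - 1)"
    proof -
      have "a powr z * a powr (x - z) = a powr x" "a powr z * a powr (y - z) = a powr y"
        "a powr z * a powr (x + y - z) = a powr x * a powr y" "a powr z * a powr (1 - z) = a"
        using a by (simp_all flip: powr_add)
      then show ?thesis by (simp add: g_def algebra_simps)
    qed
    then have ga: "g a < 0" using a by (simp add: mult_pos_neg)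
    let ?q = "\<lambda>s r. (1 - r powr s) / (1 - r)"
    \<comment> \<open>Here \<open>g r\<close> is divided by \<open>(1 - r)\<^sup>2\<close>; each
      quotient tends to its exponent at 1.\<close>
    have "((\<lambda>r. ?q z r - ?q x r * ?q y r) \<longlongrightarrow> z - x * y) (at_left 1)"
      by (intro tendsto_intros powr_difference_quotient_at_1)
    then have "\<forall>\<^sub>F r in at_left 1. 0 < ?q z r - ?q x r * ?q y r"
      by (rule order_tendstoD) (use 3 in simp)
    moreover have "\<forall>\<^sub>F r in at_left 1. a < r \<and> r < 1"
      using a eventually_at_left_real[of a 1] by simp
    ultimately have "\<forall>\<^sub>F r in at_left 1. (a < r \<and> r < 1) \<and> 0 < ?q z r - ?q x r * ?q y r"
      by (rule eventually_conj[rotated])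
    then obtain b where b: "a < b" "b < 1" "0 < ?q z b - ?q x b * ?q y b"
      using eventually_happens'[OF trivial_limit_at_left_real] by blast
    define q where "q s = ?q s b" for s
    have q: "1 - b powr s = (1 - b) * q s" for s using b by (simp add: q_def)
    have "g b = (1 - b)\<^sup>2 * (q z - q x * q y)"
      unfolding g_def q by (simp add: power2_eq_square algebra_simps)
    moreover have "0 < q z - q x * q y" using b(3) by (simp only: q_def)
    ultimately have gb: "0 < g b" using b by simp
    have "continuous_on {a..b} g"
      unfolding g_def using a by (intro continuous_intros) auto
    then obtain r where r: "a \<le> r" "r \<le> b" "g r = 0"
      using IVT'[of g a 0 b] ga gb b by auto
    have r01: "0 < r" "r < 1" using r a b by auto
    have "1 + (r powr x - 1) * (r powr y - 1) / (r - 1) = r powr z"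
      using r(3) r01 by (simp add: g_def divide_simps) (simp add: algebra_simps)
    then have "frank (ennreal r) x y = z"
      using r01 by (simp add: frank_def Let_def ennreal_eq_0_iff)
    then show thesis using r01 by (intro that[of "ennreal r"]) auto
  qed
qed

section \<open>Conclusion for the listed assessment\<close>

lemma coherent_conjunction_iff:
  assumes "logically_independent [A, H, K]" "0 \<le> x" "x \<le> 1" "0 \<le> y" "y \<le> 1"
  shows "coherent [(cond_event A H x, x), (cond_event A K y, y), (conjunction A H K x y z, z)] \<longleftrightarrow>
    x * y \<le> z \<and> z \<le> min x y"
proof -
  let ?Fs = "[(cond_event A H x, x), (cond_event A K y, y), (conjunction A H K x y z, z)]"
  interpret conjunction_assessment A H K x y z "\<lambda>i. fst (?Fs ! i)" "\<lambda>i. snd (?Fs ! i)"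
    using assms(1) by unfold_locales auto
  have "{..<length ?Fs} = {0, 1, 2}" by auto
  then show ?thesis using coherent_iff[OF assms(2-)] by (simp only: coherent_def)
qed

text \<open>On \<open>H \<union> K\<close> at least one conditional event has value 0 or 1, so
  \<open>frank_boundary\<close> decides; elsewhere the arguments are \<open>x\<close> and
  \<open>y\<close>, and the prevision was chosen as their Frank value.\<close>

lemma conjunction_eq_frank:
  assumes "l \<le> 1" "0 \<le> x" "x \<le> 1" "0 \<le> y" "y \<le> 1"
  shows "rq (conjunction A H K x y (frank l x y)) =
    (\<lambda>w. frank l (rq (cond_event A H x) w) (rq (cond_event A K y) w))"
  using assms by (auto simp: fun_eq_iff conjunction_def cond_event_def frank_boundary)

theorem theorem6:
  fixes A H K :: "'w set" and x y :: real
  assumes "logically_independent [A, H, K]"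
    and "x \<in> {0..1}" and "y \<in> {0..1}"
  shows "(\<forall>l::ennreal. l \<in> {0..1} \<longrightarrow>
            (let z = frank l x y in
               coherent [(cond_event A H x, x), (cond_event A K y, y),
                         (conjunction A H K x y z, z)] \<and>
               rq (conjunction A H K x y z) =
                 (\<lambda>w. frank l (rq (cond_event A H x) w) (rq (cond_event A K y) w)))) \<and>
         (\<forall>z::real. coherent [(cond_event A H x, x), (cond_event A K y, y),
                              (conjunction A H K x y z, z)] \<longrightarrow>
            (\<exists>l::ennreal. l \<in> {0..1} \<and> z = frank l x y))"
proof -
  have x: "0 \<le> x" "x \<le> 1" and y: "0 \<le> y" "y \<le> 1" using assms by auto
  show ?thesis
    unfolding Let_def coherent_conjunction_iff[OF assms(1) x y]
  proof (intro conjI allI impI)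
    fix l :: ennreal assume "l \<in> {0..1}"
    then have l: "l \<le> 1" by simp
    show "x * y \<le> frank l x y" "frank l x y \<le> min x y" using frank_bounds[OF l x y] .
    show "rq (conjunction A H K x y (frank l x y)) =
        (\<lambda>w. frank l (rq (cond_event A H x) w) (rq (cond_event A K y) w))"
      by (rule conjunction_eq_frank[OF l x y])
  next
    fix z assume "x * y \<le> z \<and> z \<le> min x y"
    then obtain l where "l \<le> 1" "z = frank l x y" using frank_surj[OF x y] by blast
    then show "\<exists>l::ennreal. l \<in> {0..1} \<and> z = frank l x y" by auto
  qed
qed

end
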